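(* There is an absolute constant $C$ such that for every $\epsilon\in(0,1/2]$, the algorithm SSF-W with parameter $c=\epsilon/2$, given a single machine of speed $2+\epsilon$, is $\frac{C}{\epsilon^2}$-competitive for minimizing the maximum delay factor in broadcast scheduling with unit-sized pages (relative to the optimal offline schedule on a speed-$1$ machine).
   Context: Broadcast scheduling: pages have unit size; the $i$-th request for page $p$, $J_{(p,i)}$, has arrival time $a_{(p,i)}$, deadline $d_{(p,i)}$ and slack $S_{(p,i)} = d_{(p,i)}-a_{(p,i)}$, revealed at arrival. One transmission of page $p$ satisfies all outstanding requests for $p$ that arrived before the transmission started; $f_{(p,i)}$ is the finish time. Delay factor of a schedule: $\max\{1,\max (f_{(p,i)}-a_{(p,i)})/S_{(p,i)}\}$. Algorithm SSF-W with parameter $c$: let $\alpha_t$ be the maximum delay factor SSF-W has at time $t$ (including requests not yet completed, whose current delay is measured with $t$ in place of the finish time; $\alpha_0=1$). At time $t$, let $Q(t)$ be the set of unsatisfied requests $J_{(p,i)}$ with $t - a_{(p,i)} \ge c\,\alpha_t S_{(p,i)}$. Whenever the machine is free, it broadcasts, non-preemptively, the page of the request in $Q(t)$ with the smallest slack. *)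

theory Defs
  imports "HOL-Analysis.Analysis"
begin

text \<open>
  A request is a pair \<open>(p, i)\<close>, the \<open>i\<close>-th request for page \<open>p\<close>. Pages are natural numbers rather
  than elements of a type variable, so that a constant that is quantified before the instance cannot
  depend on the type of pages; each instance has finitely many requests, so nothing is lost.
\<close>

type_synonym page = nat

type_synonym request = "page \<times> nat"

record requests =
  reqs :: "request set"
  arrival :: "request \<Rightarrow> real"
  deadline :: "request \<Rightarrow> real"

definition slack :: "requests \<Rightarrow> request \<Rightarrow> real" where
  "slack I J = deadline I J - arrival I J"

definition valid_requests :: "requests \<Rightarrow> bool" where
  "valid_requests I \<longleftrightarrow>
     finite (reqs I) \<and> (\<forall>J\<in>reqs I. 0 \<le> arrival I J \<and> 0 < slack I J)"

text \<open>
  A schedule is the set of its transmissions \<open>(b, p)\<close>, with \<open>b\<close> the start time and \<open>p\<close> the page.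
  Transmitting a page of unit size at speed \<open>s\<close> occupies the machine for time \<open>1 / s\<close>, without
  interruption.
\<close>

type_synonym schedule = "(real \<times> page) set"

definition feasible :: "real \<Rightarrow> schedule \<Rightarrow> bool" where
  "feasible s \<sigma> \<longleftrightarrow>
     (\<forall>(b, p)\<in>\<sigma>. 0 \<le> b) \<and>
     (\<forall>(b, p)\<in>\<sigma>. \<forall>(b', p')\<in>\<sigma>. (b, p) \<noteq> (b', p') \<longrightarrow> 1 / s \<le> \<bar>b - b'\<bar>)"

text \<open>The finish time is \<open>\<infinity>\<close> for a request that is never satisfied.\<close>

definition finish :: "real \<Rightarrow> requests \<Rightarrow> schedule \<Rightarrow> request \<Rightarrow> ereal" where
  "finish s I \<sigma> J = (INF b\<in>{b. (b, fst J) \<in> \<sigma> \<and> arrival I J < b}. ereal (b + 1 / s))"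

definition delay_factor :: "real \<Rightarrow> requests \<Rightarrow> schedule \<Rightarrow> ereal" where
  "delay_factor s I \<sigma> =
     Max (insert 1 ((\<lambda>J. (finish s I \<sigma> J - ereal (arrival I J)) / ereal (slack I J)) ` reqs I))"

definition opt_delay_factor :: "requests \<Rightarrow> ereal" where
  "opt_delay_factor I = (INF \<sigma>\<in>{\<sigma>. feasible 1 \<sigma>}. delay_factor 1 I \<sigma>)"

text \<open>
  The maximum delay factor at time \<open>t\<close>. The truncation of the finish time at \<open>t\<close> makes it independent
  of the transmissions that have not been completed by time \<open>t\<close>.
\<close>

definition delay_factor_at :: "real \<Rightarrow> requests \<Rightarrow> schedule \<Rightarrow> real \<Rightarrow> real" where
  "delay_factor_at s I \<sigma> t =
     Max (insert 1 ((\<lambda>J. (real_of_ereal (min (finish s I \<sigma> J) (ereal t)) - arrival I J) / slack I J)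
                     ` {J \<in> reqs I. arrival I J \<le> t}))"

definition waiting :: "real \<Rightarrow> real \<Rightarrow> requests \<Rightarrow> schedule \<Rightarrow> real \<Rightarrow> request set" where
  "waiting c s I \<sigma> t =
     {J \<in> reqs I. arrival I J \<le> t \<and> ereal t < finish s I \<sigma> J \<and>
        c * delay_factor_at s I \<sigma> t * slack I J \<le> t - arrival I J}"

definition free :: "real \<Rightarrow> schedule \<Rightarrow> real \<Rightarrow> bool" where
  "free s \<sigma> t \<longleftrightarrow> (\<forall>(b, p)\<in>\<sigma>. b < t \<longrightarrow> b + 1 / s \<le> t)"

text \<open>
  The schedules that SSF-W with parameter \<open>c\<close> can produce at speed \<open>s\<close>; they differ only in how ties
  between requests of equal slack are broken.
\<close>

definition ssf_w :: "real \<Rightarrow> real \<Rightarrow> requests \<Rightarrow> schedule \<Rightarrow> bool" where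
  "ssf_w c s I \<sigma> \<longleftrightarrow>
     feasible s \<sigma> \<and>
     (\<forall>(t, p)\<in>\<sigma>. \<exists>J\<in>waiting c s I \<sigma> t.
        fst J = p \<and> (\<forall>J'\<in>waiting c s I \<sigma> t. slack I J \<le> slack I J')) \<and>
     (\<forall>t\<ge>0. free s \<sigma> t \<and> waiting c s I \<sigma> t \<noteq> {} \<longrightarrow> (\<exists>p. (t, p) \<in> \<sigma>))"

text \<open>
  \<open>A I\<close> is the set of schedules that an algorithm can produce on the instance \<open>I\<close>; the bound has to
  hold for each of them.
\<close>

definition competitive :: "(requests \<Rightarrow> schedule \<Rightarrow> bool) \<Rightarrow> real \<Rightarrow> real \<Rightarrow> bool" where
  "competitive A s \<rho> \<longleftrightarrow>
     (\<forall>I \<sigma>. valid_requests I \<and> A I \<sigma> \<longrightarrow> delay_factor s I \<sigma> \<le> ereal \<rho> * opt_delay_factor I)"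

text \<open>SSF-W is well-defined: it produces a schedule on every instance.\<close>

lemma finish_insert:
  assumes "t < t0 + 1 / s"
  shows "min (finish s I (insert (t0, p) \<sigma>) J) (ereal t) = min (finish s I \<sigma> J) (ereal t)"
proof -
  have "finish s I (insert (t0, p) \<sigma>) J =
      (if fst J = p \<and> arrival I J < t0 then min (ereal (t0 + 1 / s)) (finish s I \<sigma> J) else finish s I \<sigma> J)"
  proof (cases "fst J = p \<and> arrival I J < t0")
    case True
    then have "{b. (b, fst J) \<in> insert (t0, p) \<sigma> \<and> arrival I J < b} =
        insert t0 {b. (b, fst J) \<in> \<sigma> \<and> arrival I J < b}" by auto
    then show ?thesis using True by (simp add: finish_def inf_min)
  next
    case False
    then have "{b. (b, fst J) \<in> insert (t0, p) \<sigma> \<and> arrival I J < b} =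
        {b. (b, fst J) \<in> \<sigma> \<and> arrival I J < b}" by auto
    then show ?thesis using False by (auto simp: finish_def)
  qed
  moreover have "min (min (ereal (t0 + 1 / s)) y) (ereal t) = min y (ereal t)" for y
    using assms by (cases y) (auto simp: min_def)
  ultimately show ?thesis by simp
qed

lemma waiting_insert:
  assumes "t < t0 + 1 / s"
  shows "waiting c s I (insert (t0, p) \<sigma>) t = waiting c s I \<sigma> t"
proof -
  have "ereal t < finish s I (insert (t0, p) \<sigma>) J \<longleftrightarrow> ereal t < finish s I \<sigma> J" for J
  proof -
    define u where "u = (t + (t0 + 1 / s)) / 2"
    have u: "t < u" "u < t0 + 1 / s" using assms by (auto simp: u_def)
    have "ereal t < y \<longleftrightarrow> ereal t < min y (ereal u)" for y using u by simp
    then show ?thesis using finish_insert[OF u(2)] by metis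
  qed
  then show ?thesis
    by (simp add: waiting_def delay_factor_at_def finish_insert[OF assms])
qed

lemma first_waiting:
  assumes v: "valid_requests I" and c: "0 < c" and s: "0 < s"
    and dn: "\<forall>(b, p)\<in>\<sigma>. b + 1 / s \<le> T"
    and ne: "T \<le> t1" "waiting c s I \<sigma> t1 \<noteq> {}"
  obtains t0 where "T \<le> t0" "waiting c s I \<sigma> t0 \<noteq> {}"
    "\<And>t. T \<le> t \<Longrightarrow> t < t0 \<Longrightarrow> waiting c s I \<sigma> t = {}"
proof -
  define g where "g J t = (real_of_ereal (min (finish s I \<sigma> J) (ereal t)) - arrival I J) / slack I J" for J t
  define A where "A = {t. T \<le> t \<and> waiting c s I \<sigma> t \<noteq> {}}"
  define B where "B J = {t. T \<le> t \<and> arrival I J \<le> t \<and> c * slack I J \<le> t - arrival I J \<and>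
      (\<forall>J'\<in>reqs I. g J' t * (c * slack I J) \<le> t - arrival I J)}" for J
  have fin: "finite (reqs I)" and pos: "\<And>J. J \<in> reqs I \<Longrightarrow> 0 \<le> arrival I J \<and> 0 < slack I J"
    using v by (auto simp: valid_requests_def)
  have inf: "ereal t < finish s I \<sigma> J \<longleftrightarrow> finish s I \<sigma> J = \<infinity>" if "T \<le> t" for t J
  proof (cases "{b. (b, fst J) \<in> \<sigma> \<and> arrival I J < b} = {}")
    case True
    then show ?thesis unfolding finish_def True by (simp add: top_ereal_def)
  next
    case False
    then obtain b where b: "(b, fst J) \<in> \<sigma>" "arrival I J < b" by auto
    then have "finish s I \<sigma> J \<le> ereal (b + 1 / s)" unfolding finish_def by (intro INF_lower) auto
    also have "\<dots> \<le> ereal t" using dn b that by force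
    finally show ?thesis by auto
  qed
  have neg: "g J t \<le> 0" if "J \<in> reqs I" "t < arrival I J" "0 \<le> t" for J t
  proof -
    have "real_of_ereal (min y (ereal t)) \<le> arrival I J" for y
      using that pos[OF that(1)] by (cases y) (auto simp: min_def)
    then show ?thesis using pos[OF that(1)] by (simp add: g_def divide_nonpos_pos)
  qed
  have iff: "J \<in> waiting c s I \<sigma> t \<longleftrightarrow> t \<in> B J" if J: "J \<in> reqs I" "finish s I \<sigma> J = \<infinity>" and t: "T \<le> t" for J t
  proof -
    have sp: "0 < c * slack I J" using pos J c by simp
    have m: "delay_factor_at s I \<sigma> t \<le> x \<longleftrightarrow> 1 \<le> x \<and> (\<forall>J'\<in>reqs I. arrival I J' \<le> t \<longrightarrow> g J' t \<le> x)" for x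
      using fin by (auto simp: delay_factor_at_def g_def)
    have "c * delay_factor_at s I \<sigma> t * slack I J \<le> t - arrival I J \<longleftrightarrow>
        delay_factor_at s I \<sigma> t \<le> (t - arrival I J) / (c * slack I J)"
      using sp by (simp add: pos_le_divide_eq mult_ac)
    also have "\<dots> \<longleftrightarrow> c * slack I J \<le> t - arrival I J \<and>
        (\<forall>J'\<in>reqs I. arrival I J' \<le> t \<longrightarrow> g J' t * (c * slack I J) \<le> t - arrival I J)"
      unfolding m using sp by (simp add: pos_le_divide_eq)
    finally have e: "c * delay_factor_at s I \<sigma> t * slack I J \<le> t - arrival I J \<longleftrightarrow> c * slack I J \<le> t - arrival I J \<and>
        (\<forall>J'\<in>reqs I. arrival I J' \<le> t \<longrightarrow> g J' t * (c * slack I J) \<le> t - arrival I J)" .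
    have z: "g J' t * (c * slack I J) \<le> t - arrival I J"
      if "J' \<in> reqs I" "\<not> arrival I J' \<le> t" "arrival I J \<le> t" for J'
    proof -
      have "g J' t \<le> 0" using neg that pos[OF J(1)] by simp
      then have "g J' t * (c * slack I J) \<le> 0" using sp by (simp add: mult_nonpos_nonneg)
      then show ?thesis using that by simp
    qed
    show ?thesis using J t z by (auto simp: waiting_def e B_def)
  qed
  have "A = (\<Union>J\<in>{J\<in>reqs I. finish s I \<sigma> J = \<infinity>}. B J)"
  proof (intro set_eqI iffI)
    fix t assume "t \<in> A"
    then obtain J where J: "T \<le> t" "J \<in> waiting c s I \<sigma> t" by (auto simp: A_def)
    then have "J \<in> reqs I" "finish s I \<sigma> J = \<infinity>" using inf[of t J] by (auto simp: waiting_def)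
    then show "t \<in> (\<Union>J\<in>{J\<in>reqs I. finish s I \<sigma> J = \<infinity>}. B J)" using iff J by blast
  next
    fix t assume "t \<in> (\<Union>J\<in>{J\<in>reqs I. finish s I \<sigma> J = \<infinity>}. B J)"
    then obtain J where J: "J \<in> reqs I" "finish s I \<sigma> J = \<infinity>" "t \<in> B J" by blast
    then have "T \<le> t" by (simp add: B_def)
    then show "t \<in> A" using iff[OF J(1,2)] J(3) by (auto simp: A_def)
  qed
  moreover have "closed (B J)" for J
  proof -
    have cont: "continuous_on UNIV (g J')" for J'
    proof -
      have "continuous_on UNIV (\<lambda>t. real_of_ereal (min y (ereal t)))" for y
      proof (cases y)
        case (real r)
        then have "real_of_ereal (min y (ereal t)) = min r t" for t
          by (auto simp: min_def)
        moreover have "continuous_on UNIV (\<lambda>t. min r t)" by (intro continuous_intros)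
        ultimately show ?thesis by presburger
      qed simp_all
      then show ?thesis unfolding g_def divide_inverse by (intro continuous_intros)
    qed
    have "B J = {T..} \<inter> {arrival I J..} \<inter> {t. c * slack I J \<le> t - arrival I J} \<inter>
        (\<Inter>J'\<in>reqs I. {t. g J' t * (c * slack I J) \<le> t - arrival I J})"
      by (auto simp: B_def)
    then show ?thesis
      by (auto intro!: closed_Int closed_INT closed_Collect_le continuous_intros cont)
  qed
  ultimately have cl: "closed A" using fin by (auto intro!: closed_UN)
  have bd: "bdd_below A" by (auto simp: A_def bdd_below_def)
  have "Inf A \<in> A" using closed_contains_Inf[OF _ bd cl] ne by (auto simp: A_def)
  moreover have "waiting c s I \<sigma> t = {}" if "T \<le> t" "t < Inf A" for t
    using cInf_lower[OF _ bd, of t] that by (force simp: A_def)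
  ultimately show ?thesis using that by (auto simp: A_def)
qed

lemma ssf_w_extend:
  assumes v: "valid_requests I" and c: "0 < c" and s: "0 < s"
  shows "\<lbrakk>card {J \<in> reqs I. finish s I \<sigma> J = \<infinity>} = n; 0 \<le> T; feasible s \<sigma>; \<forall>(b, p)\<in>\<sigma>. b + 1 / s \<le> T;
     \<forall>(t, p)\<in>\<sigma>. \<exists>J\<in>waiting c s I \<sigma> t. fst J = p \<and> (\<forall>J'\<in>waiting c s I \<sigma> t. slack I J \<le> slack I J');
     \<forall>t\<ge>0. t < T \<longrightarrow> free s \<sigma> t \<and> waiting c s I \<sigma> t \<noteq> {} \<longrightarrow> (\<exists>p. (t, p) \<in> \<sigma>)\<rbrakk>
     \<Longrightarrow> \<exists>\<sigma>. ssf_w c s I \<sigma>"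
proof (induction n arbitrary: \<sigma> T rule: less_induct)
  case (less n)
  note h = less.prems
  have fin: "finite (reqs I)" using v by (auto simp: valid_requests_def)
  show ?case
  proof (cases "\<exists>t1\<ge>T. waiting c s I \<sigma> t1 \<noteq> {}")
    case False
    then have "ssf_w c s I \<sigma>" using h(3,5,6) unfolding ssf_w_def
      by (intro conjI allI impI) (assumption+, meson not_le)
    then show ?thesis by blast
  next
    case True
    then obtain t0 where t0: "T \<le> t0" "waiting c s I \<sigma> t0 \<noteq> {}"
      "\<And>t. T \<le> t \<Longrightarrow> t < t0 \<Longrightarrow> waiting c s I \<sigma> t = {}"
      using first_waiting[OF v c s h(4)] by metis
    have "finite (waiting c s I \<sigma> t0)" using fin by (simp add: waiting_def)
    then obtain J where J: "J \<in> waiting c s I \<sigma> t0" "\<forall>J'\<in>waiting c s I \<sigma> t0. slack I J \<le> slack I J'"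
      using t0(2) by (metis arg_min_if_finite(1) arg_min_least)
    let ?\<sigma> = "insert (t0, fst J) \<sigma>"
    have s': "0 < 1 / s" using s by simp
    have w: "waiting c s I ?\<sigma> t = waiting c s I \<sigma> t" if "t < t0 + 1 / s" for t
      using waiting_insert[OF that] .
    have b2: "t + 1 / s \<le> t0" if "(t, p) \<in> \<sigma>" for t p
      using h(4) that t0(1) by force
    have b1: "t < t0 + 1 / s" if "(t, p) \<in> \<sigma>" for t p
      using b2[OF that] s' by linarith
    have JR: "J \<in> reqs I" "ereal t0 < finish s I \<sigma> J" using J by (auto simp: waiting_def)
    have Jinf: "finish s I \<sigma> J = \<infinity>"
    proof (rule ccontr)
      assume "finish s I \<sigma> J \<noteq> \<infinity>"
      then have "{b. (b, fst J) \<in> \<sigma> \<and> arrival I J < b} \<noteq> {}"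
        unfolding finish_def by (metis Inf_empty image_empty top_ereal_def)
      then obtain x where "(x, fst J) \<in> \<sigma>" "arrival I J < x" by auto
      moreover from this have "finish s I \<sigma> J \<le> ereal (x + 1 / s)"
        unfolding finish_def by (intro INF_lower) auto
      ultimately show False using b2 JR(2) by (metis ereal_less_eq(3) leD order_trans)
    qed
    have aJ: "arrival I J < t0"
    proof -
      have "1 \<le> delay_factor_at s I \<sigma> t0" using fin by (simp add: delay_factor_at_def)
      moreover have "0 < slack I J" using v JR by (simp add: valid_requests_def)
      ultimately have "0 < c * delay_factor_at s I \<sigma> t0 * slack I J" using c by simp
      then show ?thesis using J(1) by (simp add: waiting_def)
    qed
    have sub: "finish s I ?\<sigma> K \<le> finish s I \<sigma> K" for K
      unfolding finish_def by (rule INF_superset_mono) auto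
    have "finish s I ?\<sigma> J \<le> ereal (t0 + 1 / s)"
      unfolding finish_def using aJ by (intro INF_lower) auto
    then have "finish s I ?\<sigma> J \<noteq> \<infinity>" by auto
    moreover have "finish s I \<sigma> K = \<infinity>" if "finish s I ?\<sigma> K = \<infinity>" for K
      using sub[of K] that by simp
    ultimately have "{K \<in> reqs I. finish s I ?\<sigma> K = \<infinity>} \<subset> {K \<in> reqs I. finish s I \<sigma> K = \<infinity>}"
      using JR(1) Jinf by blast
    then have card: "card {K \<in> reqs I. finish s I ?\<sigma> K = \<infinity>} < n"
      using h(1) fin psubset_card_mono[of "{K \<in> reqs I. finish s I \<sigma> K = \<infinity>}"] by simp
    show ?thesis
    proof (rule less.IH[OF card refl, of "t0 + 1 / s"])
      show "0 \<le> t0 + 1 / s" using h(2) t0(1) s' by linarith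
      show "feasible s ?\<sigma>"
        unfolding feasible_def
      proof (intro conjI ballI, goal_cases)
        case (1 x)
        then show ?case using h(2,3) t0(1) by (auto simp: feasible_def)
      next
        case (2 x)
        have far: "1 / s \<le> \<bar>t - t0\<bar>" "1 / s \<le> \<bar>t0 - t\<bar>" if "(t, p) \<in> \<sigma>" for t p
          using b2[OF that] s' by linarith+
        have old: "1 / s \<le> \<bar>t - t'\<bar>" if "(t, p) \<in> \<sigma>" "(t', p') \<in> \<sigma>" "(t, p) \<noteq> (t', p')" for t p t' p'
        proof -
          have "\<forall>(b, p)\<in>\<sigma>. \<forall>(b', p')\<in>\<sigma>. (b, p) \<noteq> (b', p') \<longrightarrow> 1 / s \<le> \<bar>b - b'\<bar>"
            using h(3) by (simp add: feasible_def)
          from bspec[OF this that(1)] have "\<forall>(b', p')\<in>\<sigma>. (t, p) \<noteq> (b', p') \<longrightarrow> 1 / s \<le> \<bar>t - b'\<bar>"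
            by simp
          from bspec[OF this that(2)] show ?thesis using that(3) by simp
        qed
        show ?case
        proof (cases x)
          case (Pair t p)
          have "1 / s \<le> \<bar>t - t'\<bar>" if "(t', p') \<in> ?\<sigma>" "(t, p) \<noteq> (t', p')" for t' p'
            using 2 Pair that far[of t p] far[of t' p'] old[of t p t' p'] by blast
          then show ?thesis using Pair by blast
        qed
      qed
      show "\<forall>(b, p)\<in>?\<sigma>. b + 1 / s \<le> t0 + 1 / s" 
      proof (intro ballI, clarify)
        fix t p assume "(t, p) \<in> ?\<sigma>"
        then show "t + 1 / s \<le> t0 + 1 / s" using b1[of t p] b2[of t p] s'
          by (cases "(t, p) \<in> \<sigma>") (linarith, simp)
      qed
      show "\<forall>(t, p)\<in>?\<sigma>. \<exists>J\<in>waiting c s I ?\<sigma> t. fst J = p \<and>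
          (\<forall>J'\<in>waiting c s I ?\<sigma> t. slack I J \<le> slack I J')"
      proof (intro ballI, clarify)
        fix t p assume "(t, p) \<in> ?\<sigma>"
        then consider "(t, p) \<in> \<sigma>" | "t = t0" "p = fst J" by blast
        then show "\<exists>J\<in>waiting c s I ?\<sigma> t. fst J = p \<and> (\<forall>J'\<in>waiting c s I ?\<sigma> t. slack I J \<le> slack I J')"
        proof cases
          case 1
          then show ?thesis using bspec[OF h(5) 1] unfolding w[OF b1[OF 1]] by simp
        next
          case 2
          have "t < t0 + 1 / s" using 2 s' by linarith
          then show ?thesis using J 2 unfolding w[OF \<open>t < t0 + 1 / s\<close>] by blast
        qed
      qed
      show "\<forall>t\<ge>0. t < t0 + 1 / s \<longrightarrow> free s ?\<sigma> t \<and> waiting c s I ?\<sigma> t \<noteq> {} \<longrightarrow> (\<exists>p. (t, p) \<in> ?\<sigma>)"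
      proof (intro allI impI)
        fix t assume t: "0 \<le> t" "t < t0 + 1 / s" and fw: "free s ?\<sigma> t \<and> waiting c s I ?\<sigma> t \<noteq> {}"
        have "t \<le> t0" 
        proof -
          have "\<forall>(b, p)\<in>?\<sigma>. b < t \<longrightarrow> b + 1 / s \<le> t" using fw by (simp add: free_def)
          from bspec[OF this insertI1] show ?thesis using t(2) by auto
        qed
        moreover have "free s \<sigma> t" using fw by (auto simp: free_def)
        moreover have "waiting c s I \<sigma> t \<noteq> {}" using fw unfolding w[OF t(2)] by blast
        ultimately consider "t = t0" | "t < T" using t0(3)[of t] by linarith
        then show "\<exists>p. (t, p) \<in> ?\<sigma>"
        proof cases
          case 2
          then show ?thesis using h(6) t(1) \<open>free s \<sigma> t\<close> \<open>waiting c s I \<sigma> t \<noteq> {}\<close> by blast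
        qed blast
      qed
    qed
  qed
qed

lemma ssf_w_exists:
  assumes "valid_requests I" "0 < c" "0 < s"
  shows "\<exists>\<sigma>. ssf_w c s I \<sigma>"
  by (rule ssf_w_extend[OF assms refl, where \<sigma> = "{}" and T = 0]) (simp_all add: feasible_def)

end

theory Submission
  imports Defs
begin

text \<open>
  Fix a horizon \<open>h\<close> and let \<open>\<alpha>\<close> be the delay factor of SSF-W at time \<open>h\<close>, attained by a request \<open>K\<close>
  with slack \<open>S\<close>. Suppose that \<open>\<alpha> > 4 A / \<epsilon>\<^sup>2\<close>, where \<open>A\<close> is slightly larger than the optimal delay
  factor. Go back from the end of the delay of \<open>K\<close> for as long as the queue contains a request of
  slack at most \<open>S\<close> and the current delay factor is at least \<open>2 A / \<epsilon>\<close>. During this period SSF-W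
  never idles and every transmission is triggered by a request of slack at most \<open>S\<close> that arrived
  at most \<open>c \<alpha> S\<close> before the period. Two transmissions of the same page are triggered by requests
  whose arrival times differ by more than \<open>A\<close> times the slack of the first one, so the optimal
  schedule needs a separate transmission for each trigger. It has to fit all of them
  into the period extended by \<open>c \<alpha> S\<close> to the left and \<open>A S\<close> to the right, which is too short.
\<close>

section \<open>Current delay factors\<close>

lemma finish_le:
  assumes "(b, fst J) \<in> \<sigma>" "arrival I J < b"
  shows "finish s I \<sigma> J \<le> ereal (b + 1 / s)"
  unfolding finish_def using assms by (intro INF_lower) auto

lemma arrival_le_finish:
  assumes "0 < s"
  shows "ereal (arrival I J) \<le> finish s I \<sigma> J"
  unfolding finish_def
proof (intro INF_greatest)
  fix b assume "b \<in> {b. (b, fst J) \<in> \<sigma> \<and> arrival I J < b}"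
  moreover have "0 < 1 / s" using assms by simp
  ultimately have "arrival I J \<le> b + 1 / s" by (simp add: add_increasing2 less_imp_le)
  then show "ereal (arrival I J) \<le> ereal (b + 1 / s)" by simp
qed

text \<open>\<open>real_of_ereal\<close> never falls back to its default 0 here: truncation at
  \<open>t\<close> excludes infinity, and finishing no earlier than the arrival excludes minus
  infinity.\<close>

lemma ereal_min_finish:
  assumes "0 < s"
  shows "ereal (real_of_ereal (min (finish s I \<sigma> J) (ereal t))) = min (finish s I \<sigma> J) (ereal t)"
  using arrival_le_finish[OF assms, of I J \<sigma>]
  by (cases "finish s I \<sigma> J") (auto simp: min_def)

lemma delay_factor_at_ge_1:
  assumes "valid_requests I"
  shows "1 \<le> delay_factor_at s I \<sigma> t"
  using assms by (auto simp: delay_factor_at_def valid_requests_def)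

text \<open>Truncation at \<open>t\<close> is harmless, since the delay reaches \<open>x\<close>
  times the slack no later than \<open>t\<close>. This and the converse below turn the truncated
  maximum into comparisons of time points.\<close>

lemma delay_factor_at_ge:
  assumes v: "valid_requests I" and s: "0 < s" and J: "J \<in> reqs I" and x: "0 \<le> x"
    and t: "arrival I J + x * slack I J \<le> t"
    and f: "ereal (arrival I J + x * slack I J) \<le> finish s I \<sigma> J"
  shows "x \<le> delay_factor_at s I \<sigma> t"
proof -
  have sl: "0 < slack I J" using v J by (auto simp: valid_requests_def)
  let ?m = "real_of_ereal (min (finish s I \<sigma> J) (ereal t))"
  have "ereal (arrival I J + x * slack I J) \<le> ereal ?m"
    unfolding ereal_min_finish[OF s] using t f by simp
  then have "x \<le> (?m - arrival I J) / slack I J" using sl by (simp add: pos_le_divide_eq)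
  moreover have "arrival I J \<le> t" using t x sl
    by (meson add_increasing2 dual_order.trans less_imp_le mult_nonneg_nonneg order_refl)
  then have "(?m - arrival I J) / slack I J \<le> delay_factor_at s I \<sigma> t"
    unfolding delay_factor_at_def using v J by (intro Max_ge) (auto simp: valid_requests_def)
  ultimately show ?thesis by linarith
qed

text \<open>Above the default value 1, the maximum must come from a request.\<close>

lemma delay_factor_at_attained:
  assumes v: "valid_requests I" and s: "0 < s" and gt: "1 < delay_factor_at s I \<sigma> t"
  obtains J where "J \<in> reqs I"
    "arrival I J + delay_factor_at s I \<sigma> t * slack I J \<le> t"
    "ereal (arrival I J + delay_factor_at s I \<sigma> t * slack I J) \<le> finish s I \<sigma> J"
proof -
  let ?m = "\<lambda>J. real_of_ereal (min (finish s I \<sigma> J) (ereal t))"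
  have "delay_factor_at s I \<sigma> t \<in>
      insert 1 ((\<lambda>J. (?m J - arrival I J) / slack I J) ` {J \<in> reqs I. arrival I J \<le> t})"
    unfolding delay_factor_at_def using v by (intro Max_in) (auto simp: valid_requests_def)
  then obtain J where J: "J \<in> reqs I"
    and e: "delay_factor_at s I \<sigma> t = (?m J - arrival I J) / slack I J"
    using gt by auto
  have "0 < slack I J" using v J by (auto simp: valid_requests_def)
  then have m: "arrival I J + delay_factor_at s I \<sigma> t * slack I J = ?m J" by (simp add: e)
  have "ereal (?m J) \<le> ereal t" "ereal (?m J) \<le> finish s I \<sigma> J"
    unfolding ereal_min_finish[OF s] by auto
  then show ?thesis using that[OF J] unfolding m by simp
qed

lemma delay_factor_at_mono:
  assumes v: "valid_requests I" and s: "0 < s" and "u \<le> t"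
  shows "delay_factor_at s I \<sigma> u \<le> delay_factor_at s I \<sigma> t"
proof (cases "1 < delay_factor_at s I \<sigma> u")
  case True
  then show ?thesis
    using delay_factor_at_attained[OF v s True] delay_factor_at_ge[OF v s] \<open>u \<le> t\<close>
    by (smt (verit))
next
  case False
  then show ?thesis using delay_factor_at_ge_1[OF v, of s \<sigma> t] by linarith
qed

lemma delay_factor_le_if_delay_factor_at_le:
  assumes v: "valid_requests I" and s: "0 < s" and le: "\<And>t. delay_factor_at s I \<sigma> t \<le> r"
  shows "delay_factor s I \<sigma> \<le> ereal r"
proof -
  have r: "1 \<le> r" using delay_factor_at_ge_1[OF v] le order_trans by blast
  have "(finish s I \<sigma> J - ereal (arrival I J)) / ereal (slack I J) \<le> ereal r" if J: "J \<in> reqs I" for J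
  proof -
    have sl: "0 < slack I J" using v J by (auto simp: valid_requests_def)
    have "finish s I \<sigma> J \<le> ereal (arrival I J + r * slack I J)"
    proof (rule ccontr)
      assume "\<not> ?thesis"
      then have "ereal (arrival I J + r * slack I J) < finish s I \<sigma> J" by simp
      \<comment> \<open>A real \<open>q\<close> in between exists even if the finish time is
        infinite. At time \<open>q\<close> the request is unfinished and its current delay factor
        already exceeds \<open>r\<close>.\<close>
      from ereal_dense2[OF this] obtain q
        where q: "ereal (arrival I J + r * slack I J) < ereal q" "ereal q < finish s I \<sigma> J" by auto
      define x where "x = (q - arrival I J) / slack I J"
      have qx: "q = arrival I J + x * slack I J" using sl by (simp add: x_def)
      then have "r < x" using q sl by simp
      moreover have "x \<le> delay_factor_at s I \<sigma> q"
        using delay_factor_at_ge[OF v s J, of x q] qx q \<open>r < x\<close> r by simp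
      ultimately show False using le[of q] by linarith
    qed
    then show ?thesis using sl
      by (cases "finish s I \<sigma> J") (auto simp: pos_divide_le_eq)
  qed
  then show ?thesis
    using v r by (auto simp: delay_factor_def valid_requests_def)
qed

text \<open>A strict bound on the infimum in \<open>finish\<close> is met by an actual transmission,
  whether or not the infimum is attained.\<close>

lemma start_before_bound:
  assumes v: "valid_requests I" and lt: "delay_factor s I \<sigma> < ereal A" and J: "J \<in> reqs I"
  obtains b where "(b, fst J) \<in> \<sigma>" "arrival I J < b" "b + 1 / s < arrival I J + A * slack I J"
proof -
  have sl: "0 < slack I J" using v J by (auto simp: valid_requests_def)
  have "(finish s I \<sigma> J - ereal (arrival I J)) / ereal (slack I J) \<le> delay_factor s I \<sigma>"
    unfolding delay_factor_def using v J by (intro Max_ge) (auto simp: valid_requests_def)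
  then have "(finish s I \<sigma> J - ereal (arrival I J)) / ereal (slack I J) < ereal A"
    using lt by (rule le_less_trans)
  then have "finish s I \<sigma> J < ereal (arrival I J + A * slack I J)"
    using sl by (cases "finish s I \<sigma> J") (auto simp: pos_divide_less_eq)
  then show ?thesis using that unfolding finish_def INF_less_iff by auto
qed

section \<open>Counting transmissions\<close>

text \<open>Separated points lie in distinct unit cells \<open>[lo + k, lo + k + 1)\<close>, and
  \<open>k\<close> ranges from 0 to the floor of \<open>hi - lo\<close>.\<close>

lemma card_separated_le:
  fixes X :: "real set"
  assumes sep: "\<And>x y. x \<in> X \<Longrightarrow> y \<in> X \<Longrightarrow> x \<noteq> y \<Longrightarrow> 1 \<le> \<bar>x - y\<bar>"
    and X: "X \<subseteq> {lo..hi}" and ne: "X \<noteq> {}"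
  shows "real (card X) \<le> hi - lo + 1"
proof -
  have inj: "inj_on (\<lambda>x. \<lfloor>x - lo\<rfloor>) X"
  proof (rule inj_onI, rule ccontr)
    fix x y assume xy: "x \<in> X" "y \<in> X" "\<lfloor>x - lo\<rfloor> = \<lfloor>y - lo\<rfloor>" "x \<noteq> y"
    then have "\<bar>x - y\<bar> < 1" by linarith
    then show False using sep[of x y] xy by simp
  qed
  have "(\<lambda>x. \<lfloor>x - lo\<rfloor>) ` X \<subseteq> {0..\<lfloor>hi - lo\<rfloor>}"
    using X by (auto intro!: floor_mono dest!: subsetD)
  then have "card X \<le> card {0..\<lfloor>hi - lo\<rfloor>}" using card_inj_on_le[OF inj] by blast
  moreover have "0 \<le> hi - lo" using ne X by fastforce
  ultimately show ?thesis by (simp add: zero_le_floor) linarith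
qed

text \<open>A machine that never idles is busy at each of the times \<open>x + i / s\<close>, with a different
  transmission for each \<open>i\<close>. The time \<open>x\<close> itself is left out, since its transmission may have started
  earlier.\<close>

lemma busy_starts:
  assumes s: "0 < s" and x0: "0 \<le> x"
    and busy: "\<And>t. x \<le> t \<Longrightarrow> t < y \<Longrightarrow> free s \<sigma> t \<Longrightarrow> \<exists>p. (t, p) \<in> \<sigma>"
  obtains N where "finite N" "N \<subseteq> fst ` \<sigma>" "N \<subseteq> {x..<y}" "s * (y - x) - 1 \<le> real (card N)"
proof -
  \<comment> \<open>The indices \<open>i < n\<close> are those with
    \<open>x + i / s < y\<close>.\<close>
  define n where "n = nat \<lceil>s * (y - x)\<rceil>"
  have less: "x + real i / s < y" if "i < n" for i
  proof -
    have "real i < s * (y - x)" using that unfolding n_def by linarith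
    then show ?thesis using s by (simp add: field_simps)
  qed
  have "\<exists>b. b \<in> fst ` \<sigma> \<and> b \<le> x + real i / s \<and> x + real i / s < b + 1 / s" if i: "i < n" for i
  proof (cases "free s \<sigma> (x + real i / s)")
    case True
    have "x \<le> x + real i / s" using s by simp
    then obtain p where "(x + real i / s, p) \<in> \<sigma>" using busy less[OF i] True by blast
    then show ?thesis using s by (intro exI[of _ "x + real i / s"]) force
  next
    case False
    then obtain b p where "(b, p) \<in> \<sigma>" "b < x + real i / s" "\<not> b + 1 / s \<le> x + real i / s"
      unfolding free_def by blast
    then show ?thesis by (intro exI[of _ b]) force
  qed
  then obtain g where g: "\<And>i. i < n \<Longrightarrow> g i \<in> fst ` \<sigma>" "\<And>i. i < n \<Longrightarrow> g i \<le> x + real i / s"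
    "\<And>i. i < n \<Longrightarrow> x + real i / s < g i + 1 / s" by metis
  define N where "N = g ` {1..<n}"
  have inj: "inj_on g {1..<n}"
  proof (rule inj_onI)
    fix i j assume ij: "i \<in> {1..<n}" "j \<in> {1..<n}" "g i = g j"
    have "\<bar>real i / s - real j / s\<bar> < 1 / s"
      using g(2,3)[of i] g(2,3)[of j] ij by simp
    then have "\<bar>real i - real j\<bar> < 1"
      using s by (simp flip: diff_divide_distrib add: abs_divide divide_less_cancel)
    then show "i = j" by linarith
  qed
  show ?thesis
  proof (rule that)
    show "finite N" by (simp add: N_def)
    show "N \<subseteq> fst ` \<sigma>" using g(1) by (auto simp: N_def)
    show "N \<subseteq> {x..<y}"
    proof
      fix b assume "b \<in> N"
      then obtain i where i: "1 \<le> i" "i < n" "b = g i" by (auto simp: N_def)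
      \<comment> \<open>As \<open>i\<close> is at least 1, a transmission running at
        \<open>x + i / s\<close> starts after \<open>x + (i - 1) / s\<close>, hence after
        \<open>x\<close>.\<close>
      have "1 / s \<le> real i / s" using i s by (simp add: divide_right_mono)
      then show "b \<in> {x..<y}" using g(2,3)[of i] less[of i] i by simp
    qed
    have "real (card N) = real (n - 1)" using card_image[OF inj] by (simp add: N_def)
    then show "s * (y - x) - 1 \<le> real (card N)" unfolding n_def by linarith
  qed
qed

section \<open>SSF-W against a schedule of bounded delay factor\<close>

text \<open>The current delay factor grows with time, so its value at \<open>h\<close> gives one
  waiting time that suffices for all requests of slack at most \<open>S\<close> at all times up to
  \<open>h\<close>.\<close>

lemma waiting_after:
  assumes v: "valid_requests I" and s: "0 < s" and c: "0 \<le> c"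
    and J: "J \<in> reqs I" "slack I J \<le> S" and t: "t \<le> h" "ereal t < finish s I \<sigma> J"
    and w: "arrival I J + c * delay_factor_at s I \<sigma> h * S \<le> t"
  shows "J \<in> waiting c s I \<sigma> t"
proof -
  let ?D = "delay_factor_at s I \<sigma>"
  have sl: "0 < slack I J" using v J by (auto simp: valid_requests_def)
  have D: "1 \<le> ?D h" "1 \<le> ?D t" "?D t \<le> ?D h"
    using delay_factor_at_ge_1[OF v] delay_factor_at_mono[OF v s t(1)] by auto
  have "c * ?D t * slack I J \<le> c * ?D h * S"
    using D sl J c by (intro mult_mono mult_left_mono) auto
  moreover have "0 \<le> c * ?D t * slack I J" using D c sl by simp
  ultimately show ?thesis using J(1) t(2) w by (auto simp: waiting_def)
qed

text \<open>The comparison is with one schedule strictly below \<open>A\<close>, because the infimum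
  defining the optimum need not be attained.\<close>

lemma delay_factor_at_ssf_w:
  fixes \<epsilon> A :: real
  assumes v: "valid_requests I" and eps: "0 < \<epsilon>" "\<epsilon> \<le> 1 / 2"
    and ssf: "ssf_w (\<epsilon> / 2) (2 + \<epsilon>) I \<sigma>"
    and opt: "feasible 1 \<sigma>'" "delay_factor 1 I \<sigma>' < ereal A" and A: "1 < A"
  shows "delay_factor_at (2 + \<epsilon>) I \<sigma> h \<le> 4 / \<epsilon>\<^sup>2 * A"
proof (rule ccontr)
  define s c where "s = 2 + \<epsilon>" and "c = \<epsilon> / 2"
  define D where "D = delay_factor_at s I \<sigma>"
  define W where "W = waiting c s I \<sigma>"
  \<comment> \<open>In terms of \<open>c\<close> the negated goal reads
    \<open>\<alpha> > A / c\<^sup>2\<close>. Taking \<open>\<beta> = A / c\<close> gives both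
    \<open>c * \<beta> = A\<close> and \<open>\<beta> < c * \<alpha>\<close>.\<close>
  define \<alpha> \<beta> where "\<alpha> = D h" and "\<beta> = 2 * A / \<epsilon>"
  assume "\<not> ?thesis"
  then have big: "4 / \<epsilon>\<^sup>2 * A < \<alpha>" by (simp add: \<alpha>_def D_def s_def)
  have s: "0 < s" and c: "0 < c" using eps by (auto simp: s_def c_def)
  have \<beta>: "c * \<beta> = A" "1 < \<beta>" using eps A by (auto simp: c_def \<beta>_def field_simps)
  have \<beta>\<alpha>: "\<beta> < c * \<alpha>"
    using big eps by (simp add: \<beta>_def c_def field_simps power2_eq_square)
  have \<alpha>16: "16 * A < \<alpha>"
  proof -
    have "\<epsilon>\<^sup>2 \<le> (1 / 2)\<^sup>2" using eps by (intro power_mono) auto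
    then have "16 \<le> 4 / \<epsilon>\<^sup>2" using eps by (simp add: field_simps power2_eq_square)
    then have "16 * A \<le> 4 / \<epsilon>\<^sup>2 * A" using A by (intro mult_right_mono) auto
    then show ?thesis using big by linarith
  qed
  have c\<alpha>: "c * \<alpha> \<le> \<alpha> / 4" using eps A \<alpha>16 by (simp add: c_def)
  have pos: "0 \<le> arrival I J" "0 < slack I J" if "J \<in> reqs I" for J
    using v that by (auto simp: valid_requests_def)
  have fin: "finite (reqs I)" using v by (auto simp: valid_requests_def)
  have "1 < D h" using \<alpha>16 A by (simp add: \<alpha>_def)
  then obtain K where K: "K \<in> reqs I" "arrival I K + \<alpha> * slack I K \<le> h"
    "ereal (arrival I K + \<alpha> * slack I K) \<le> finish s I \<sigma> K"
    using delay_factor_at_attained[OF v s] unfolding D_def \<alpha>_def by metis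
  \<comment> \<open>\<open>f\<close> is the moment at which the delay factor of \<open>K\<close>
    reaches \<open>\<alpha>\<close>; the period under study ends there.\<close>
  define S f where "S = slack I K" and "f = arrival I K + \<alpha> * S"
  have S: "0 < S" and f: "f \<le> h" "ereal f \<le> finish s I \<sigma> K"
    using pos K by (auto simp: S_def f_def)
  have short: "J \<in> W t" if "J \<in> reqs I" "slack I J \<le> S" "t < f" "ereal t < finish s I \<sigma> J"
    "arrival I J + c * \<alpha> * S \<le> t" for J t
    using waiting_after[OF v s less_imp_le[OF c], of J S t h \<sigma>] that f
    by (simp add: W_def \<alpha>_def D_def)
  define P where "P t \<longleftrightarrow> (\<exists>J\<in>W t. slack I J \<le> S)" for t

  \<comment> \<open>The start of the period is sought among finitely many times, those at which some
    request has waited \<open>c * \<alpha> * S\<close>, so the earliest one exists.\<close>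
  define Ts where "Ts = {T \<in> (\<lambda>J. arrival I J + c * \<alpha> * S) ` reqs I. \<forall>t. T \<le> t \<and> t < f \<longrightarrow> P t}"
  define T where "T = Min Ts"
  have "K \<in> W t" if "arrival I K + c * \<alpha> * S \<le> t" "t < f" for t
  proof (rule short)
    show "ereal t < finish s I \<sigma> K" using that f by (metis ereal_less(2) less_ereal.simps(1) less_le_trans)
  qed (use that K S_def in auto)
  then have KT: "arrival I K + c * \<alpha> * S \<in> Ts" using K by (auto simp: Ts_def P_def S_def)
  have finT: "finite Ts" using fin by (simp add: Ts_def)
  have "T \<in> Ts" unfolding T_def using finT KT by (intro Min_in) auto
  then have PT: "P t" if "T \<le> t" "t < f" for t using that by (auto simp: Ts_def)
  have TK: "T \<le> arrival I K + c * \<alpha> * S" unfolding T_def using finT KT by (rule Min_le)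

  \<comment> \<open>The first time at which the current delay factor reaches \<open>\<beta>\<close>.\<close>
  define Us where "Us = (\<lambda>J. arrival I J + \<beta> * slack I J) `
    {J \<in> reqs I. ereal (arrival I J + \<beta> * slack I J) \<le> finish s I \<sigma> J}"
  define U where "U = Min Us"
  have finU: "finite Us" using fin by (simp add: Us_def)
  have "\<beta> \<le> \<alpha>" using \<beta>\<alpha> c\<alpha> \<alpha>16 A by linarith
  then have "arrival I K + \<beta> * S \<le> f" using S by (simp add: f_def)
  then have "ereal (arrival I K + \<beta> * S) \<le> finish s I \<sigma> K"
    using f(2) by (meson ereal_less_eq(3) order_trans)
  then have KU: "arrival I K + \<beta> * S \<in> Us" using K by (auto simp: Us_def S_def)
  have "U \<in> Us" unfolding U_def using finU KU by (intro Min_in) auto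
  then obtain JU where JU: "JU \<in> reqs I" "U = arrival I JU + \<beta> * slack I JU"
    "ereal (arrival I JU + \<beta> * slack I JU) \<le> finish s I \<sigma> JU" by (auto simp: Us_def)
  have DU: "\<beta> \<le> D t" if "U \<le> t" for t
    unfolding D_def using delay_factor_at_ge[OF v s JU(1), of \<beta> t \<sigma>] JU \<beta> that by simp
  have "0 \<le> \<beta> * slack I JU" using \<beta> pos[OF JU(1)] by simp
  then have U0: "0 \<le> U" using JU pos[OF JU(1)] by linarith
  have "U \<le> arrival I K + \<beta> * S" unfolding U_def using finU KU by (rule Min_le)
  moreover have \<beta>S: "\<beta> * S \<le> c * \<alpha> * S" using \<beta>\<alpha> S by simp
  ultimately have UK: "U \<le> arrival I K + c * \<alpha> * S" by linarith

  define x where "x = max T U"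
  have x: "0 \<le> x" "T \<le> x" "U \<le> x" "x \<le> arrival I K + c * \<alpha> * S"
    using U0 TK UK by (auto simp: x_def)
  have busy: "\<exists>p. (t, p) \<in> \<sigma>" if "x \<le> t" "t < f" "free s \<sigma> t" for t
  proof -
    have "W t \<noteq> {}" using PT[of t] that x by (auto simp: P_def)
    moreover have "0 \<le> t" using that x by linarith
    ultimately show ?thesis using ssf that(3) unfolding ssf_w_def W_def s_def c_def by blast
  qed
  obtain N where N: "finite N" "N \<subseteq> fst ` \<sigma>" "N \<subseteq> {x..<f}" "s * (f - x) - 1 \<le> real (card N)"
    using busy_starts[OF s x(1) busy] by blast

  have "\<exists>J. J \<in> W b \<and> (b, fst J) \<in> \<sigma> \<and> slack I J \<le> S \<and> x - c * \<alpha> * S \<le> arrival I J" if b: "b \<in> N" for b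
  proof -
    obtain p where p: "(b, p) \<in> \<sigma>" using N b by auto
    have "\<forall>(t, p)\<in>\<sigma>. \<exists>J\<in>W t. fst J = p \<and> (\<forall>J'\<in>W t. slack I J \<le> slack I J')"
      using ssf by (simp add: ssf_w_def W_def s_def c_def)
    from bspec[OF this p] obtain J where J: "J \<in> W b" "fst J = p" "\<forall>J'\<in>W b. slack I J \<le> slack I J'"
      by auto
    have xb: "x \<le> b" "b < f" using N b by auto
    have "P b" using PT xb x by simp
    then have JS: "slack I J \<le> S" using J(3) by (force simp: P_def)
    have JR: "J \<in> reqs I" and Jf: "ereal b < finish s I \<sigma> J" using J by (auto simp: W_def waiting_def)
    \<comment> \<open>Otherwise the period could start earlier: \<open>J\<close> itself keeps a
      short request in the queue up to time \<open>b\<close>, and from \<open>T\<close> on there is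
      one anyway. This contradicts the minimality of \<open>T\<close>.\<close>
    have "T \<le> arrival I J + c * \<alpha> * S"
    proof (rule ccontr)
      assume n: "\<not> ?thesis"
      have "P t" if t: "arrival I J + c * \<alpha> * S \<le> t" "t < f" for t
      proof (cases "t \<le> b")
        case True
        then have "ereal t < finish s I \<sigma> J" using Jf by (meson ereal_less_eq(3) le_less_trans)
        then show ?thesis using short[OF JR JS t(2) _ t(1)] JS by (auto simp: P_def)
      next
        case False
        then show ?thesis using PT[of t] xb x t by simp
      qed
      then have "arrival I J + c * \<alpha> * S \<in> Ts" using JR by (auto simp: Ts_def)
      then have "T \<le> arrival I J + c * \<alpha> * S" unfolding T_def by (rule Min_le[OF finT])
      then show False using n by simp
    qed
    \<comment> \<open>Otherwise \<open>J\<close>, still unfinished at \<open>b\<close>, would reach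
      delay factor \<open>\<beta>\<close> before \<open>U\<close>, as
      \<open>\<beta> * S \<le> c * \<alpha> * S\<close>.\<close>
    moreover have "U \<le> arrival I J + c * \<alpha> * S"
    proof (rule ccontr)
      assume n: "\<not> ?thesis"
      have "\<beta> * slack I J \<le> \<beta> * S" using JS \<beta> by simp
      then have l: "arrival I J + \<beta> * slack I J < U" using n \<beta>S by linarith
      then have "arrival I J + \<beta> * slack I J \<le> b" using x xb by linarith
      then have "ereal (arrival I J + \<beta> * slack I J) \<le> finish s I \<sigma> J"
        using Jf by (meson ereal_less_eq(3) less_imp_le order_trans)
      then have "arrival I J + \<beta> * slack I J \<in> Us" using JR by (auto simp: Us_def)
      then have "U \<le> arrival I J + \<beta> * slack I J" unfolding U_def by (rule Min_le[OF finU])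
      then show False using l by simp
    qed
    ultimately have "x - c * \<alpha> * S \<le> arrival I J" by (simp add: x_def)
    then show ?thesis using J JS p by blast
  qed
  then obtain w where w: "\<And>b. b \<in> N \<Longrightarrow> w b \<in> W b" "\<And>b. b \<in> N \<Longrightarrow> (b, fst (w b)) \<in> \<sigma>"
    "\<And>b. b \<in> N \<Longrightarrow> slack I (w b) \<le> S" "\<And>b. b \<in> N \<Longrightarrow> x - c * \<alpha> * S \<le> arrival I (w b)"
    by metis
  have wR: "w b \<in> reqs I" "ereal b < finish s I \<sigma> (w b)"
    "arrival I (w b) + c * D b * slack I (w b) \<le> b" if "b \<in> N" for b
    using w(1)[OF that] by (auto simp: W_def waiting_def D_def)
  have "\<exists>z. (z, fst (w b)) \<in> \<sigma>' \<and> arrival I (w b) < z \<and> z + 1 < arrival I (w b) + A * slack I (w b)"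
    if b: "b \<in> N" for b
    using start_before_bound[OF v opt(2) wR(1)[OF b]] by (metis div_by_1)
  then obtain z where z: "\<And>b. b \<in> N \<Longrightarrow> (z b, fst (w b)) \<in> \<sigma>'"
    "\<And>b. b \<in> N \<Longrightarrow> arrival I (w b) < z b"
    "\<And>b. b \<in> N \<Longrightarrow> z b + 1 < arrival I (w b) + A * slack I (w b)"
    by metis
  have sep': "1 \<le> \<bar>b - b'\<bar>" if "(b, p) \<in> \<sigma>'" "(b', p') \<in> \<sigma>'" "(b, p) \<noteq> (b', p')" for b p b' p'
    using opt(1) that by (fastforce simp: feasible_def)
  have sep: "1 / s \<le> \<bar>b - b'\<bar>" if "(b, p) \<in> \<sigma>" "(b', p') \<in> \<sigma>" "(b, p) \<noteq> (b', p')" for b p b' p'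
    using ssf that unfolding ssf_w_def feasible_def s_def by fastforce

  have distinct: "z b \<noteq> z b'" if b: "b \<in> N" "b' \<in> N" "b < b'" for b b'
  proof
    assume e: "z b = z b'"
    have pe: "fst (w b) = fst (w b')"
      using sep'[OF z(1)[OF b(1)] z(1)[OF b(2)]] e by auto
    have "1 / s \<le> \<bar>b - b'\<bar>" using sep[OF w(2)[OF b(1)] w(2)[OF b(2)]] b by auto
    then have bb: "b + 1 / s \<le> b'" using b by simp
    \<comment> \<open>Had \<open>w b'\<close> arrived before \<open>b\<close>, the transmission at
      \<open>b\<close> would have satisfied it by time \<open>b'\<close>.\<close>
    have "b \<le> arrival I (w b')"
    proof (rule ccontr)
      assume "\<not> ?thesis"
      then have "finish s I \<sigma> (w b') \<le> ereal (b + 1 / s)"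
        using w(2)[OF b(1)] pe by (intro finish_le) auto
      also have "\<dots> \<le> ereal b'" using bb by simp
      finally show False using wR(2)[OF b(2)] by simp
    qed
    \<comment> \<open>From \<open>U\<close> on the delay factor is at least \<open>\<beta>\<close>,
      so \<open>w b\<close> waits at least \<open>A\<close> times its slack. The shared offline
      transmission would have to end before \<open>b\<close> and yet start after the arrival of
      \<open>w b'\<close>.\<close>
    moreover have "A * slack I (w b) \<le> c * D b * slack I (w b)"
    proof (rule mult_right_mono)
      have "\<beta> \<le> D b" using DU x N b by fastforce
      then show "A \<le> c * D b" using \<beta>(1) c by (metis mult_left_mono less_imp_le)
    qed (use pos wR b in \<open>simp add: less_imp_le\<close>)
    ultimately show False using wR(3)[OF b(1)] z(2)[OF b(2)] z(3)[OF b(1)] e by linarith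
  qed
  then have inj: "inj_on z N" by (metis inj_onI linorder_neqE_linordered_idom)

  \<comment> \<open>The offline schedule must fit a unit transmission for \<open>K\<close> into
    \<open>A * S\<close>. This later absorbs the additive 1 lost in counting.\<close>
  have AS: "1 < A * S" using start_before_bound[OF v opt(2) K(1)] by (fastforce simp: S_def)
  have L: "(1 - c) * \<alpha> * S \<le> f - x" using x by (simp add: f_def algebra_simps)
  have "0 < (1 - c) * \<alpha> * S" using eps \<alpha>16 A S by (simp add: c_def)
  have "real (card (z ` N)) \<le> (f + A * S - 1) - (x - c * \<alpha> * S) + 1"
  proof (cases "N = {}")
    case True
    have "0 < c * \<alpha> * S" using c \<alpha>16 A S by simp
    then show ?thesis using True AS L \<open>0 < (1 - c) * \<alpha> * S\<close> by simp
  next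
    case False
    show ?thesis
    proof (rule card_separated_le)
      show "z ` N \<subseteq> {x - c * \<alpha> * S..f + A * S - 1}"
      proof
        fix y assume "y \<in> z ` N"
        then obtain b where b: "b \<in> N" "y = z b" by auto
        have "0 \<le> c * D b * slack I (w b)"
          using c delay_factor_at_ge_1[OF v, of s \<sigma> b] pos[OF wR(1)[OF b(1)]] by (simp add: D_def)
        moreover have "b < f" using N b by auto
        moreover have "A * slack I (w b) \<le> A * S" using A w(3)[OF b(1)] by simp
        ultimately show "y \<in> {x - c * \<alpha> * S..f + A * S - 1}"
          using w(4)[OF b(1)] wR(3)[OF b(1)] z(2,3)[OF b(1)] b by simp
      qed
    qed (use False z(1) sep' in blast)+
  qed
  then have "s * (f - x) - 1 \<le> f - x + A * S + c * \<alpha> * S"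
    using N(4) card_image[OF inj] by simp
  then have "(1 + \<epsilon>) * (f - x) \<le> A * S + c * \<alpha> * S + 1" by (simp add: s_def algebra_simps)
  moreover have "(1 + \<epsilon>) * ((1 - c) * \<alpha> * S) \<le> (1 + \<epsilon>) * (f - x)"
    using L eps by (intro mult_left_mono) auto
  ultimately have "(1 + \<epsilon>) * ((1 - c) * \<alpha> * S) < 2 * (A * S) + c * \<alpha> * S" using AS by linarith
  then have "((1 + \<epsilon>) * (1 - c) * \<alpha> - c * \<alpha>) * S < (2 * A) * S" by (simp add: algebra_simps)
  then have "(1 + \<epsilon>) * (1 - c) * \<alpha> - c * \<alpha> < 2 * A" using S by simp
  \<comment> \<open>Since \<open>c\<close> is at most 1/4, the coefficient of
    \<open>\<alpha>\<close> is at least \<open>1 - 2 * c\<close>, hence at least 1/2. Then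
    \<open>\<alpha> < 4 * A\<close>, against \<open>\<alpha>16\<close>.\<close>
  moreover have "\<alpha> / 2 \<le> (1 + \<epsilon>) * (1 - c) * \<alpha> - c * \<alpha>"
  proof -
    have "1 * (1 - c) \<le> (1 + \<epsilon>) * (1 - c)" using eps by (intro mult_right_mono) (auto simp: c_def)
    then have "(1 - c) * \<alpha> \<le> (1 + \<epsilon>) * (1 - c) * \<alpha>" using \<alpha>16 A by (intro mult_right_mono) auto
    then show ?thesis using c\<alpha> by (simp add: algebra_simps)
  qed
  ultimately show False using \<alpha>16 A by linarith
qed

section \<open>Passage to the infimum over offline schedules\<close>

theorem theorem3p5:
  "\<exists>C::real. \<forall>\<epsilon>::real. 0 < \<epsilon> \<and> \<epsilon> \<le> 1 / 2 \<longrightarrow>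
     competitive (ssf_w (\<epsilon> / 2) (2 + \<epsilon>)) (2 + \<epsilon>) (C / \<epsilon>\<^sup>2)"
proof (intro exI[of _ 4] allI impI)
  fix \<epsilon> :: real assume eps: "0 < \<epsilon> \<and> \<epsilon> \<le> 1 / 2"
  show "competitive (ssf_w (\<epsilon> / 2) (2 + \<epsilon>)) (2 + \<epsilon>) (4 / \<epsilon>\<^sup>2)"
    unfolding competitive_def
  proof (intro allI impI, elim conjE)
    fix I \<sigma> assume v: "valid_requests I" and ssf: "ssf_w (\<epsilon> / 2) (2 + \<epsilon>) I \<sigma>"
    have \<rho>: "0 < 4 / \<epsilon>\<^sup>2" using eps by simp
    have ge1: "1 \<le> delay_factor 1 I \<tau>" for \<tau>
      using v by (auto simp: delay_factor_def valid_requests_def)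
    have bound: "delay_factor (2 + \<epsilon>) I \<sigma> \<le> ereal (4 / \<epsilon>\<^sup>2 * A)" if lt: "opt_delay_factor I < ereal A" for A
    proof -
      obtain \<tau> where \<tau>: "feasible 1 \<tau>" "delay_factor 1 I \<tau> < ereal A"
        using lt unfolding opt_delay_factor_def INF_less_iff by auto
      have "1 < ereal A" using ge1 \<tau>(2) by (rule le_less_trans)
      then have "1 < A" by simp
      then have "delay_factor_at (2 + \<epsilon>) I \<sigma> h \<le> 4 / \<epsilon>\<^sup>2 * A" for h
        using delay_factor_at_ssf_w[OF v _ _ ssf \<tau>] eps by blast
      then show ?thesis using delay_factor_le_if_delay_factor_at_le[OF v] eps by simp
    qed
    show "delay_factor (2 + \<epsilon>) I \<sigma> \<le> ereal (4 / \<epsilon>\<^sup>2) * opt_delay_factor I"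
    proof (cases "opt_delay_factor I")
      case (real r)
      show ?thesis
      proof (rule ereal_le_epsilon2)
        fix e :: real assume e: "0 < e"
        \<comment> \<open>The excess over \<open>r\<close> is scaled so that multiplication by the
          competitive ratio turns it into exactly \<open>e\<close>.\<close>
        have "r < r + e / (4 / \<epsilon>\<^sup>2)" using e \<rho> by simp
        then have "delay_factor (2 + \<epsilon>) I \<sigma> \<le> ereal (4 / \<epsilon>\<^sup>2 * (r + e / (4 / \<epsilon>\<^sup>2)))"
          by (intro bound) (simp only: real less_ereal.simps)
        also have "4 / \<epsilon>\<^sup>2 * (r + e / (4 / \<epsilon>\<^sup>2)) = 4 / \<epsilon>\<^sup>2 * r + e" using \<rho> eps by (simp add: field_simps)
        finally show "delay_factor (2 + \<epsilon>) I \<sigma> \<le> ereal (4 / \<epsilon>\<^sup>2) * opt_delay_factor I + ereal e"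
          using real by simp
      qed
    next
      case PInf
      then show ?thesis using \<rho> by simp
    next
      case MInf
      moreover have "1 \<le> opt_delay_factor I"
        unfolding opt_delay_factor_def by (intro INF_greatest ge1)
      ultimately show ?thesis by simp
    qed
  qed
qed

end
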